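(* Let $X$ be a normed linear space, $A,B\subset X$, $a\in A$, $b\in B$, and let the set-valued mappings $F:X\rightrightarrows X\times X$ and $S:X\times X\rightrightarrows X$ be defined by $$F(x):=(A-x)\times(B-x),\quad x\in X,\qquad S(y,z):=(A-y)\cap(B-z),\quad y,z\in X.$$ (i) $\{A,B\}$ is extremal relative to $a$ and $b$ if and only if $(a,b)\in\mathrm{bd}\,F(X)$, or equivalently, $(a,b)\in\mathrm{bd}\,\mathrm{dom}\,S$. (ii) $\{A,B\}$ is locally extremal relative to $a$ and $b$ if and only if there exists a $\rho>0$ such that (a) $(a,b)\in\mathrm{bd}\,F(\rho\mathbb{B})$, or equivalently, (b) for any $\varepsilon>0$ there is a pair $(y,z)\in\mathbb{B}_\varepsilon(a,b)$ such that $S(y,z)\cap(\rho\mathbb{B})=\emptyset$. (iii) $\{A,B\}$ is stationary relative to $a$ and $b$ if and only if for any $\varepsilon>0$ there exists a $\rho\in(0,\varepsilon)$ such that (a) $\mathbb{B}_{\varepsilon\rho}(a,b)\not\subset F(\rho\mathbb{B})$, or equivalently, (b) there is a pair $(y,z)\in\mathbb{B}_{\varepsilon\rho}(a,b)$ such that $S(y,z)\cap(\rho\mathbb{B})=\emptyset$. (iv) $\{A,B\}$ is approximately stationary relative to $a$ and $b$ if and only if for any $\varepsilon>0$ there exist a $\rho\in(0,\varepsilon)$ and points $a'\in A\cap\mathbb{B}_\varepsilon(a)$, $b'\in B\cap\mathbb{B}_\varepsilon(b)$ such that (a) $\mathbb{B}_{\varepsilon\rho}(a',b')\not\subset F(\rho\mathbb{B})$,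 or equivalently, (b) there is a pair $(y,z)\in\mathbb{B}_{\varepsilon\rho}(a',b')$ such that $S(y,z)\cap(\rho\mathbb{B})=\emptyset$.
   Context: $\mathbb{B}$ is the closed unit ball of $X$, $\rho\mathbb{B}$ is the closed ball of radius $\rho$ centered at $0$, and $\mathbb{B}_\delta(x)$ is the open ball of radius $\delta$ centered at $x$. The product $X\times X$ carries the maximum norm $\|(y,z)\|=\max\{\|y\|,\|z\|\}$, and $\mathbb{B}_\delta(y,z)$ is the open ball in $X\times X$ of radius $\delta$ centered at $(y,z)$. $\mathrm{bd}$ denotes the topological boundary. A set-valued mapping assigns to each point a (possibly empty) set; $F(U)=\bigcup_{x\in U}F(x)$, and $\mathrm{dom}\,S=\{(y,z)\mid S(y,z)\neq\emptyset\}$. Definitions, for $a\in A$ and $b\in B$. The pair $\{A,B\}$ is: - extremal relative to $a$ and $b$ if for any $\varepsilon>0$ there are $u,v\in X$ with $(A-a-u)\cap(B-b-v)=\emptyset$ and $\max\{\|u\|,\|v\|\}<\varepsilon$; - locally extremal relative to $a$ and $b$ if there exists a $\rho>0$ such that for any $\varepsilon>0$ there are $u,v\in X$ with $(A-a-u)\cap(B-b-v)\cap(\rho\mathbb{B})=\emptyset$ and $\max\{\|u\|,\|v\|\}<\varepsilon$; - stationary relative to $a$ and $b$ if for any $\varepsilon>0$ there exist a $\rho\in(0,\varepsilon)$ and $u,v\in X$ with $(A-a-u)\cap(B-b-v)\cap(\rho\mathbb{B})=\emptyset$ and $\max\{\|u\|,\|v\|\}<\varepsilon\rho$; - approximately stationary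 relative to $a$ and $b$ if for any $\varepsilon>0$ there exist a $\rho\in(0,\varepsilon)$, points $a'\in A\cap\mathbb{B}_\varepsilon(a)$, $b'\in B\cap\mathbb{B}_\varepsilon(b)$ and $u,v\in X$ with $(A-a'-u)\cap(B-b'-v)\cap(\rho\mathbb{B})=\emptyset$ and $\max\{\|u\|,\|v\|\}<\varepsilon\rho$. *)

theory Defs
  imports "HOL-Analysis.Analysis"
begin

definition shift :: "'a::real_normed_vector set \<Rightarrow> 'a \<Rightarrow> 'a set" where
  "shift A x = (\<lambda>p. p - x) ` A"

text \<open>The library norm on a product type is the Euclidean combination of the component
  norms, so the maximum norm and its open balls are defined separately. Both norms induce the
  product topology (lemma \<open>open_iff_max_ball\<close> below), hence the library's \<^const>\<open>frontier\<close>
  is also the boundary with respect to the maximum norm.\<close>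

definition max_norm :: "'a::real_normed_vector \<times> 'a \<Rightarrow> real" where
  "max_norm p = max (norm (fst p)) (norm (snd p))"

definition max_ball :: "'a::real_normed_vector \<times> 'a \<Rightarrow> real \<Rightarrow> ('a \<times> 'a) set" where
  "max_ball p d = {q. max_norm (q - p) < d}"

lemma max_ball_eq_Times: "max_ball (y, z) d = ball y d \<times> ball z d"
  by (auto simp: max_ball_def max_norm_def dist_norm norm_minus_commute)

lemma open_iff_max_ball:
  fixes U :: "('a::real_normed_vector \<times> 'a) set"
  shows "open U \<longleftrightarrow> (\<forall>p\<in>U. \<exists>e>0. max_ball p e \<subseteq> U)"
proof
  assume U: "open U"
  show "\<forall>p\<in>U. \<exists>e>0. max_ball p e \<subseteq> U"
  proof
    fix p assume "p \<in> U"
    then obtain V W where VW: "open V" "open W" "p \<in> V \<times> W" "V \<times> W \<subseteq> U"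
      using open_prod_elim[OF U] by blast
    obtain y z where p: "p = (y, z)" by (cases p)
    have yz: "y \<in> V" "z \<in> W" using VW(3) p by auto
    obtain d where d: "d > 0" "ball y d \<subseteq> V"
      by (rule openE[OF VW(1) yz(1)])
    obtain e where e: "e > 0" "ball z e \<subseteq> W"
      by (rule openE[OF VW(2) yz(2)])
    have "ball y (min d e) \<subseteq> V" "ball z (min d e) \<subseteq> W" using d e by auto
    then have "max_ball p (min d e) \<subseteq> U"
      using VW(4) unfolding p max_ball_eq_Times by blast
    with d e show "\<exists>e>0. max_ball p e \<subseteq> U" by (intro exI[of _ "min d e"]) auto
  qed
next
  assume R: "\<forall>p\<in>U. \<exists>e>0. max_ball p e \<subseteq> U"
  show "open U"
  proof (rule open_prod_intro)
    fix p assume "p \<in> U"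
    then obtain e where e: "e > 0" "max_ball p e \<subseteq> U" using R by blast
    obtain y z where p: "p = (y, z)" by (cases p)
    show "\<exists>V W. open V \<and> open W \<and> p \<in> V \<times> W \<and> V \<times> W \<subseteq> U"
      using e unfolding p max_ball_eq_Times
      by (intro exI[of _ "ball y e"] exI[of _ "ball z e"]) auto
  qed
qed

definition sv_image :: "('a \<Rightarrow> 'b set) \<Rightarrow> 'a set \<Rightarrow> 'b set" where
  "sv_image F U = (\<Union>x\<in>U. F x)"

definition sv_dom :: "('a \<Rightarrow> 'b set) \<Rightarrow> 'a set" where
  "sv_dom S = {p. S p \<noteq> {}}"

definition F_map :: "'a::real_normed_vector set \<Rightarrow> 'a set \<Rightarrow> 'a \<Rightarrow> ('a \<times> 'a) set" where
  "F_map A B x = shift A x \<times> shift B x"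

definition S_map :: "'a::real_normed_vector set \<Rightarrow> 'a set \<Rightarrow> 'a \<times> 'a \<Rightarrow> 'a set" where
  "S_map A B = (\<lambda>(y, z). shift A y \<inter> shift B z)"

text \<open>The four properties below are meant for points \<open>a \<in> A\<close> and \<open>b \<in> B\<close>. For \<open>\<rho> > 0\<close>,
  the set \<open>cball 0 \<rho>\<close> is the multiple by \<open>\<rho>\<close> of the closed unit ball.\<close>

definition extremal ::
  "'a::real_normed_vector set \<Rightarrow> 'a set \<Rightarrow> 'a \<Rightarrow> 'a \<Rightarrow> bool" where
  "extremal A B a b \<longleftrightarrow>
    (\<forall>\<epsilon>>0. \<exists>u v. shift (shift A a) u \<inter> shift (shift B b) v = {} \<and>
       max (norm u) (norm v) < \<epsilon>)"

definition locally_extremal ::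
  "'a::real_normed_vector set \<Rightarrow> 'a set \<Rightarrow> 'a \<Rightarrow> 'a \<Rightarrow> bool" where
  "locally_extremal A B a b \<longleftrightarrow>
    (\<exists>\<rho>>0. \<forall>\<epsilon>>0. \<exists>u v.
       shift (shift A a) u \<inter> shift (shift B b) v \<inter> cball 0 \<rho> = {} \<and>
       max (norm u) (norm v) < \<epsilon>)"

definition stationary ::
  "'a::real_normed_vector set \<Rightarrow> 'a set \<Rightarrow> 'a \<Rightarrow> 'a \<Rightarrow> bool" where
  "stationary A B a b \<longleftrightarrow>
    (\<forall>\<epsilon>>0. \<exists>\<rho>\<in>{0<..<\<epsilon>}. \<exists>u v.
       shift (shift A a) u \<inter> shift (shift B b) v \<inter> cball 0 \<rho> = {} \<and>
       max (norm u) (norm v) < \<epsilon> * \<rho>)"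

definition approx_stationary ::
  "'a::real_normed_vector set \<Rightarrow> 'a set \<Rightarrow> 'a \<Rightarrow> 'a \<Rightarrow> bool" where
  "approx_stationary A B a b \<longleftrightarrow>
    (\<forall>\<epsilon>>0. \<exists>\<rho>\<in>{0<..<\<epsilon>}. \<exists>a'\<in>A \<inter> ball a \<epsilon>. \<exists>b'\<in>B \<inter> ball b \<epsilon>. \<exists>u v.
       shift (shift A a') u \<inter> shift (shift B b') v \<inter> cball 0 \<rho> = {} \<and>
       max (norm u) (norm v) < \<epsilon> * \<rho>)"

end

theory Submission
  imports Defs
begin

text \<open>The whole statement rests on the fact that \<open>F\<close> and \<open>S\<close> are inverse to each other as set-valued
  mappings: \<open>(y, z) \<in> F(x)\<close> means \<open>x + y \<in> A\<close> and \<open>x + z \<in> B\<close>, and so does \<open>x \<in> S(y, z)\<close>. Hence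
  \<open>S(y, z)\<close> misses a set \<open>U\<close> exactly when \<open>(y, z)\<close> lies outside \<open>F(U)\<close>
  (\<open>mem_image_F_map_iff\<close>). Moreover, \<open>(A - a - u) \<inter> (B - b - v)\<close> is \<open>S(a + u, b + v)\<close>, and as
  \<open>(u, v)\<close> runs through the pairs of maximum norm less than \<open>r\<close>, the point \<open>(a + u, b + v)\<close> runs
  through the open ball of radius \<open>r\<close> around \<open>(a, b)\<close>. So each of the four properties says that
  certain balls around \<open>(a, b)\<close> or \<open>(a', b')\<close> are not contained in \<open>F(U)\<close>, with \<open>U\<close> the whole space
  or a closed ball around \<open>0\<close> (\<open>exists_small_shifts_iff_not_subset\<close>).

  This gives the claims on stationarity and approximate stationarity at once. For the two
  extremality properties, the radius of the ball around \<open>(a, b)\<close> is arbitrary while \<open>U\<close> stays fixed;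
  since \<open>a \<in> A\<close> and \<open>b \<in> B\<close> put \<open>(a, b)\<close> in \<open>F(0) \<subseteq> F(U)\<close>, no small ball being contained in
  \<open>F(U)\<close> means that \<open>(a, b)\<close> is a boundary point of \<open>F(U)\<close>.\<close>

lemma mem_shift_iff: "x \<in> shift A y \<longleftrightarrow> x + y \<in> A"
  unfolding shift_def by (force simp: image_iff algebra_simps)

lemma shift_shift: "shift (shift A x) y = shift A (x + y)"
  by (auto simp: mem_shift_iff algebra_simps)

lemma mem_image_F_map_iff: "p \<in> sv_image (F_map A B) U \<longleftrightarrow> S_map A B p \<inter> U \<noteq> {}"
  by (cases p) (auto simp: sv_image_def F_map_def S_map_def mem_shift_iff add.commute)

lemma dom_S_map_eq_image_F_map: "sv_dom (S_map A B) = sv_image (F_map A B) UNIV"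
  by (auto simp: sv_dom_def mem_image_F_map_iff)

lemma mem_image_F_map_base_point:
  assumes "a \<in> A" "b \<in> B" "0 \<in> U"
  shows "(a, b) \<in> sv_image (F_map A B) U"
proof -
  have "0 \<in> S_map A B (a, b)"
    using assms(1,2) by (simp add: S_map_def mem_shift_iff)
  with assms(3) show ?thesis
    unfolding mem_image_F_map_iff by blast
qed

lemma not_subset_image_F_map_iff:
  "\<not> P \<subseteq> sv_image (F_map A B) U \<longleftrightarrow> (\<exists>(y, z)\<in>P. S_map A B (y, z) \<inter> U = {})"
  by (auto simp: subset_iff mem_image_F_map_iff)

text \<open>The substitution \<open>(y, z) = (a + u, b + v)\<close> turns a pair of translations that separates the
  two sets inside \<open>U\<close> into a point of the ball around \<open>(a, b)\<close> outside \<open>F(U)\<close>, and back.\<close>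

lemma exists_small_shifts_iff_not_subset:
  "(\<exists>u v. shift (shift A a) u \<inter> shift (shift B b) v \<inter> U = {} \<and> max (norm u) (norm v) < r) \<longleftrightarrow>
     \<not> max_ball (a, b) r \<subseteq> sv_image (F_map A B) U"
  (is "?L \<longleftrightarrow> ?R")
proof
  assume ?L
  then obtain u v where "S_map A B (a + u, b + v) \<inter> U = {}" "max (norm u) (norm v) < r"
    by (auto simp: shift_shift S_map_def)
  then show ?R
    unfolding not_subset_image_F_map_iff
    by (intro bexI[of _ "(a + u, b + v)"]) (auto simp: max_ball_def max_norm_def)
next
  assume ?R
  then obtain y z where "S_map A B (y, z) \<inter> U = {}" "(y, z) \<in> max_ball (a, b) r"
    unfolding not_subset_image_F_map_iff by auto
  then show ?L
    by (intro exI[of _ "y - a"] exI[of _ "z - b"])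
      (simp add: shift_shift S_map_def max_ball_def max_norm_def)
qed

lemma mem_interior_iff_max_ball: "p \<in> interior T \<longleftrightarrow> (\<exists>e>0. max_ball p e \<subseteq> T)"
proof
  assume "p \<in> interior T"
  then show "\<exists>e>0. max_ball p e \<subseteq> T"
    by (metis open_interior open_iff_max_ball interior_subset subset_trans)
next
  assume "\<exists>e>0. max_ball p e \<subseteq> T"
  then obtain e where e: "e > 0" "max_ball p e \<subseteq> T" by blast
  have "open (max_ball p e)" "p \<in> max_ball p e"
    using e(1) by (cases p; simp add: max_ball_eq_Times open_Times)+
  with e(2) show "p \<in> interior T" by (blast intro: interiorI)
qed

lemma mem_frontier_iff_max_ball:
  assumes "p \<in> T"
  shows "p \<in> frontier T \<longleftrightarrow> (\<forall>e>0. \<not> max_ball p e \<subseteq> T)"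
  using assms closure_subset[of T] by (auto simp: frontier_def mem_interior_iff_max_ball)

theorem proposition14:
  fixes A B :: "'a::real_normed_vector set" and a b :: 'a
  assumes "a \<in> A" and "b \<in> B"
  shows
    "((extremal A B a b \<longleftrightarrow> (a, b) \<in> frontier (sv_image (F_map A B) UNIV)) \<and>
      (extremal A B a b \<longleftrightarrow> (a, b) \<in> frontier (sv_dom (S_map A B)))) \<and>
     ((locally_extremal A B a b \<longleftrightarrow>
        (\<exists>\<rho>>0. (a, b) \<in> frontier (sv_image (F_map A B) (cball 0 \<rho>)))) \<and>
      (locally_extremal A B a b \<longleftrightarrow>
        (\<exists>\<rho>>0. \<forall>\<epsilon>>0. \<exists>(y, z)\<in>max_ball (a, b) \<epsilon>. S_map A B (y, z) \<inter> cball 0 \<rho> = {})) \<and>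
      (\<forall>\<rho>>0. (a, b) \<in> frontier (sv_image (F_map A B) (cball 0 \<rho>)) \<longleftrightarrow>
        (\<forall>\<epsilon>>0. \<exists>(y, z)\<in>max_ball (a, b) \<epsilon>. S_map A B (y, z) \<inter> cball 0 \<rho> = {}))) \<and>
     ((stationary A B a b \<longleftrightarrow>
        (\<forall>\<epsilon>>0. \<exists>\<rho>\<in>{0<..<\<epsilon>}.
           \<not> max_ball (a, b) (\<epsilon> * \<rho>) \<subseteq> sv_image (F_map A B) (cball 0 \<rho>))) \<and>
      (stationary A B a b \<longleftrightarrow>
        (\<forall>\<epsilon>>0. \<exists>\<rho>\<in>{0<..<\<epsilon>}.
           \<exists>(y, z)\<in>max_ball (a, b) (\<epsilon> * \<rho>). S_map A B (y, z) \<inter> cball 0 \<rho> = {})) \<and>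
      (\<forall>\<epsilon>>0. \<forall>\<rho>\<in>{0<..<\<epsilon>}.
         \<not> max_ball (a, b) (\<epsilon> * \<rho>) \<subseteq> sv_image (F_map A B) (cball 0 \<rho>) \<longleftrightarrow>
         (\<exists>(y, z)\<in>max_ball (a, b) (\<epsilon> * \<rho>). S_map A B (y, z) \<inter> cball 0 \<rho> = {}))) \<and>
     ((approx_stationary A B a b \<longleftrightarrow>
        (\<forall>\<epsilon>>0. \<exists>\<rho>\<in>{0<..<\<epsilon>}. \<exists>a'\<in>A \<inter> ball a \<epsilon>. \<exists>b'\<in>B \<inter> ball b \<epsilon>.
           \<not> max_ball (a', b') (\<epsilon> * \<rho>) \<subseteq> sv_image (F_map A B) (cball 0 \<rho>))) \<and>
      (approx_stationary A B a b \<longleftrightarrow>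
        (\<forall>\<epsilon>>0. \<exists>\<rho>\<in>{0<..<\<epsilon>}. \<exists>a'\<in>A \<inter> ball a \<epsilon>. \<exists>b'\<in>B \<inter> ball b \<epsilon>.
           \<exists>(y, z)\<in>max_ball (a', b') (\<epsilon> * \<rho>). S_map A B (y, z) \<inter> cball 0 \<rho> = {})) \<and>
      (\<forall>\<epsilon>>0. \<forall>\<rho>\<in>{0<..<\<epsilon>}. \<forall>a'\<in>A \<inter> ball a \<epsilon>. \<forall>b'\<in>B \<inter> ball b \<epsilon>.
         \<not> max_ball (a', b') (\<epsilon> * \<rho>) \<subseteq> sv_image (F_map A B) (cball 0 \<rho>) \<longleftrightarrow>
         (\<exists>(y, z)\<in>max_ball (a', b') (\<epsilon> * \<rho>). S_map A B (y, z) \<inter> cball 0 \<rho> = {})))"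
proof -
  have frontier_iff: "(a, b) \<in> frontier (sv_image (F_map A B) U) \<longleftrightarrow>
      (\<forall>\<epsilon>>0. \<not> max_ball (a, b) \<epsilon> \<subseteq> sv_image (F_map A B) U)" if "0 \<in> U" for U
    using that assms by (intro mem_frontier_iff_max_ball mem_image_F_map_base_point)
  have frontier_cball_iff: "(a, b) \<in> frontier (sv_image (F_map A B) (cball 0 \<rho>)) \<longleftrightarrow>
      (\<forall>\<epsilon>>0. \<not> max_ball (a, b) \<epsilon> \<subseteq> sv_image (F_map A B) (cball 0 \<rho>))" if "\<rho> > 0" for \<rho>
    using that by (intro frontier_iff) simp
  have extremal: "extremal A B a b \<longleftrightarrow> (a, b) \<in> frontier (sv_image (F_map A B) UNIV)"
    using exists_small_shifts_iff_not_subset[of A a B b UNIV]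
    by (simp add: extremal_def frontier_iff)
  have locally_extremal: "locally_extremal A B a b \<longleftrightarrow>
      (\<exists>\<rho>>0. (a, b) \<in> frontier (sv_image (F_map A B) (cball 0 \<rho>)))"
    by (simp only: locally_extremal_def exists_small_shifts_iff_not_subset frontier_cball_iff
        cong: conj_cong)
  have stationary: "stationary A B a b \<longleftrightarrow> (\<forall>\<epsilon>>0. \<exists>\<rho>\<in>{0<..<\<epsilon>}.
      \<not> max_ball (a, b) (\<epsilon> * \<rho>) \<subseteq> sv_image (F_map A B) (cball 0 \<rho>))"
    by (simp only: stationary_def exists_small_shifts_iff_not_subset)
  have approx_stationary: "approx_stationary A B a b \<longleftrightarrow>
      (\<forall>\<epsilon>>0. \<exists>\<rho>\<in>{0<..<\<epsilon>}. \<exists>a'\<in>A \<inter> ball a \<epsilon>. \<exists>b'\<in>B \<inter> ball b \<epsilon>.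
        \<not> max_ball (a', b') (\<epsilon> * \<rho>) \<subseteq> sv_image (F_map A B) (cball 0 \<rho>))"
    by (simp only: approx_stationary_def exists_small_shifts_iff_not_subset)
  show ?thesis
    unfolding dom_S_map_eq_image_F_map not_subset_image_F_map_iff[symmetric]
    using extremal locally_extremal stationary approx_stationary
    by (simp only: frontier_cball_iff cong: conj_cong) (simp add: frontier_cball_iff)
qed

end
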